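(* Let $(X,\|\cdot\|)$ be a real Banach space with closed unit ball $B_X$ and unit sphere $S_X$, let $|||\cdot|||$ be an equivalent norm on $X$, and let $B$ be the unit ball corresponding to $|||\cdot|||$. Let $x\in S_X$. (a) Assume that the restriction of $|||\cdot|||$ to $S_X$ is continuous at $x$ with respect to the weak topology. Then $x$ is a point of continuity for $B_X$ provided $x$ is a point of continuity for $B$. (b) Assume that the restriction of $|||\cdot|||$ to $S_X$ is continuous at $x$ with respect to a topology $\sigma=\sigma(X,Y)$, $Y\subset X^*$, with the property that every bounded sequence in $X$ has a $\sigma$-Cauchy subsequence, and let $x$ be an extreme point of $B_X$. Then $x$ is a strongly extreme point of $B_X$ provided it is a strongly extreme point of $B$.
   Context: $B=\{u\in X:|||u|||\le1\}$. $\sigma(X,Y)$ is the topology on $X$ generated by the functionals in $Y$; a sequence $(u_n)$ is $\sigma$-Cauchy if $(y^*(u_n))$ is Cauchy for each $y^*\in Y$. Let $D$ be a non-empty bounded closed convex set in $X$ and $x\in D$. The point $x$ is a point of continuity for $D$ if the identity map $D\to X$ is weak to norm continuous at $x$, i.e. for each $\varepsilon>0$ there is a weak neighbourhood $W$ of $x$ with $\|w-x\|<\varepsilon$ for all $w\in W\cap D$. The point $x$ is an extreme point of $D$ if $x=\frac{y+z}{2}$ with $y,z\in D$ implies $y=z=x$. The point $x$ is a strongly extreme point of $D$ if for any sequences $(y_n),(z_n)$ in $D$, $\lim_n\|x-\frac{y_n+z_n}{2}\|=0$ implies $\lim_n\|y_n-z_n\|=0$. Saying that $x$ is a point of continuity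 for $B$ or a strongly extreme point of $B$ includes $x\in B$. *)

theory Defs
  imports "HOL-Analysis.Analysis"
begin

definition equivalent_norm :: "('a::real_normed_vector \<Rightarrow> real) \<Rightarrow> bool" where
  "equivalent_norm N \<longleftrightarrow>
     (\<forall>u. 0 \<le> N u) \<and>
     (\<forall>u. N u = 0 \<longleftrightarrow> u = 0) \<and>
     (\<forall>c u. N (c *\<^sub>R u) = \<bar>c\<bar> * N u) \<and>
     (\<forall>u v. N (u + v) \<le> N u + N v) \<and>
     (\<exists>a>0. \<exists>b>0. \<forall>u. a * norm u \<le> N u \<and> N u \<le> b * norm u)"

text \<open>The topology \<open>\<sigma>(X, Y)\<close>. \<open>UNIV\<close> is inserted into the subbasis because otherwise
  \<open>Y = {}\<close> would give the topology with empty carrier instead of the indiscrete one.\<close>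

definition sigma_topology :: "('a::real_normed_vector \<Rightarrow>\<^sub>L real) set \<Rightarrow> 'a topology" where
  "sigma_topology Y =
     topology_generated_by (insert UNIV {blinfun_apply f -` U |f U. f \<in> Y \<and> open U})"

abbreviation weak_topology :: "'a::real_normed_vector topology" where
  "weak_topology \<equiv> sigma_topology UNIV"

lemma topspace_sigma_topology [simp]: "topspace (sigma_topology Y) = UNIV"
  by (simp add: sigma_topology_def)

definition sigma_Cauchy ::
    "('a::real_normed_vector \<Rightarrow>\<^sub>L real) set \<Rightarrow> (nat \<Rightarrow> 'a) \<Rightarrow> bool" where
  "sigma_Cauchy Y u \<longleftrightarrow> (\<forall>f\<in>Y. Cauchy (\<lambda>n. blinfun_apply f (u n)))"

text \<open>In the next two definitions \<open>D\<close> is meant to be non-empty, bounded, closed and convex.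
  \<open>topcontinuous_at\<close> already contains \<open>x \<in> D\<close>.\<close>

definition point_of_continuity :: "'a::real_normed_vector \<Rightarrow> 'a set \<Rightarrow> bool" where
  "point_of_continuity x D \<longleftrightarrow>
     topcontinuous_at (subtopology weak_topology D) euclidean (\<lambda>w. w) x"

definition strongly_extreme_point :: "'a::real_normed_vector \<Rightarrow> 'a set \<Rightarrow> bool" where
  "strongly_extreme_point x D \<longleftrightarrow>
     x \<in> D \<and>
     (\<forall>y z. range y \<subseteq> D \<longrightarrow> range z \<subseteq> D \<longrightarrow>
        (\<lambda>n. norm (x - (1/2) *\<^sub>R (y n + z n))) \<longlonglongrightarrow> 0 \<longrightarrow>
        (\<lambda>n. norm (y n - z n)) \<longlonglongrightarrow> 0)"

text \<open>The library notion of extreme point, stated with open segments, is the midpoint notion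
  for convex sets.\<close>

lemma extreme_point_of_midpoint:
  fixes D :: "'a::real_normed_vector set"
  assumes "convex D"
  shows "x extreme_point_of D \<longleftrightarrow>
    x \<in> D \<and> (\<forall>y\<in>D. \<forall>z\<in>D. x = (1/2) *\<^sub>R (y + z) \<longrightarrow> y = x \<and> z = x)"
    (is "_ \<longleftrightarrow> ?R")
proof
  assume L: "x extreme_point_of D"
  have "y = x \<and> z = x" if "y \<in> D" "z \<in> D" and x: "x = (1/2) *\<^sub>R (y + z)" for y z
  proof -
    have m: "x = midpoint y z" using x by (simp add: midpoint_def)
    have "x \<notin> open_segment y z"
      using L that by (auto simp: extreme_point_of_def)
    then have "y = z" using m by simp
    then show ?thesis using m by simp
  qed
  then show ?R using L by (auto simp: extreme_point_of_def)
next
  assume R: ?R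
  have "a = b" if ab: "a \<in> D" "b \<in> D" and x: "x = (1 - u) *\<^sub>R a + u *\<^sub>R b" and u: "0 < u" "u < 1"
    for a b u
  proof -
    define d where "d = min u (1 - u)"
    have d: "0 < d" "d \<le> u" "d \<le> 1 - u" using u by (auto simp: d_def)
    define p where "p = (1 - (u - d)) *\<^sub>R a + (u - d) *\<^sub>R b"
    define q where "q = (1 - (u + d)) *\<^sub>R a + (u + d) *\<^sub>R b"
    have "p \<in> D" unfolding p_def
      by (rule convexD[OF assms ab]) (use d u in auto)
    moreover have "q \<in> D" unfolding q_def
      by (rule convexD[OF assms ab]) (use d u in auto)
    moreover have "p + q = 2 *\<^sub>R x"
      unfolding p_def q_def x by (simp add: algebra_simps flip: scaleR_2)
    then have "x = (1/2) *\<^sub>R (p + q)" by simp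
    ultimately have "q = x" using R by blast
    moreover have "q - x = d *\<^sub>R (b - a)"
      unfolding q_def x by (simp add: algebra_simps)
    ultimately show ?thesis using d by simp
  qed
  then show "x extreme_point_of D"
    using R by (auto simp: extreme_point_of_def in_segment)
qed

end

theory Submission
  imports Defs
begin

text \<open>Write \<open>B\<close> for the unit ball of \<open>N\<close>. Both parts rest on one remark: if points of the unit
  sphere tend to \<open>x\<close> in a topology for which \<open>N\<close> is continuous at \<open>x\<close> on the sphere, then \<open>N\<close> of
  these points tends to \<open>N x \<le> 1\<close>, so dividing them by \<open>max 1 (N _)\<close> puts them into \<open>B\<close> and moves
  them by a norm amount that tends to \<open>0\<close>. What is known about \<open>x\<close> in \<open>B\<close> then applies to them.
  The divisor \<open>max 1 (N _)\<close>, rather than \<open>N _\<close>, treats \<open>N x < 1\<close> and \<open>N x = 1\<close> alike.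

  For points of continuity, the remark gives a basic weak neighbourhood \<open>V\<close> of \<open>x\<close>, defined by
  finitely many functionals, whose trace on the sphere is close to \<open>x\<close> in norm. If some \<open>k \<noteq> 0\<close> is
  annihilated by all of these functionals, then the line through a point \<open>u\<close> of \<open>V\<close> in the unit
  ball in direction \<open>k\<close> stays in \<open>V\<close> and meets the sphere on both sides of \<open>u\<close>; hence \<open>u\<close> is a
  convex combination of two points that are close to \<open>x\<close>, and so is itself close to \<open>x\<close>. If there is
  no such \<open>k\<close>, the functionals control the norm (\<open>common_kernel_or_norm_bound\<close>), and a
  narrow enough \<open>V\<close> is itself small in norm.

  For strongly extreme points, let the midpoints of \<open>y\<^sub>n\<close>, \<open>z\<^sub>n\<close> in the unit ball tend to \<open>x\<close>, where
  \<open>y\<^sub>n\<close>, after passing to a subsequence, may be taken to be \<open>\<sigma>\<close>-Cauchy. The \<open>\<sigma>\<close>-limit of \<open>y\<^sub>n\<close>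
  need not exist, let alone be \<open>x\<close>, but the crossed midpoints \<open>p = (y\<^sub>n + z\<^sub>m)/2\<close> and
  \<open>q = (y\<^sub>m + z\<^sub>n)/2\<close> do tend to \<open>x\<close> in \<open>\<sigma>\<close> as \<open>n, m \<rightarrow> \<infinity>\<close>, and their own midpoint
  tends to \<open>x\<close> in norm, which forces their norms to tend to \<open>1\<close>. By the remark and
  strong extremality in \<open>B\<close>, \<open>p - q\<close> tends to \<open>0\<close> (\<open>sigma_near_midpoints_collapse\<close>). Now \<open>2 (p - q)\<close>
  is the difference of \<open>y\<^sub>n - z\<^sub>n\<close> and \<open>y\<^sub>m - z\<^sub>m\<close>, so the sequence \<open>y\<^sub>n - z\<^sub>n\<close> is norm Cauchy. By
  completeness \<open>y\<^sub>n\<close> and \<open>z\<^sub>n\<close> converge in norm to points of the unit ball with midpoint \<open>x\<close>, and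
  extremality of \<open>x\<close> identifies the two limits.\<close>

section \<open>Basic neighbourhoods of the topology generated by functionals\<close>

lemma openin_sigma_topology_strip:
  fixes x :: "'a::real_normed_vector"
  assumes "finite F" "F \<subseteq> Y"
  shows "openin (sigma_topology Y) {w. \<forall>f\<in>F. \<bar>blinfun_apply f (w - x)\<bar> < \<eta>}"
  using assms
proof (induction F)
  case empty
  have "openin (sigma_topology Y) UNIV"
    using openin_topspace[of "sigma_topology Y"] by simp
  then show ?case by simp
next
  case (insert g F)
  have "{w. \<bar>blinfun_apply g (w - x)\<bar> < \<eta>} =
      blinfun_apply g -` {t. \<bar>t - blinfun_apply g x\<bar> < \<eta>}"
    by (auto simp: blinfun.diff_right)
  moreover have "open {t. \<bar>t - blinfun_apply g x\<bar> < \<eta>}"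
    by (intro open_Collect_less continuous_intros)
  ultimately have "openin (sigma_topology Y) {w. \<bar>blinfun_apply g (w - x)\<bar> < \<eta>}"
    using insert.prems unfolding sigma_topology_def
    by (intro topology_generated_by_Basis) blast
  moreover have "{w. \<forall>f\<in>insert g F. \<bar>blinfun_apply f (w - x)\<bar> < \<eta>} =
      {w. \<bar>blinfun_apply g (w - x)\<bar> < \<eta>} \<inter> {w. \<forall>f\<in>F. \<bar>blinfun_apply f (w - x)\<bar> < \<eta>}"
    by auto
  ultimately show ?case using insert by auto
qed

lemma openin_sigma_topology_contains_strip:
  fixes x :: "'a::real_normed_vector"
  assumes "openin (sigma_topology Y) U" "x \<in> U"
  shows "\<exists>F \<eta>. finite F \<and> F \<subseteq> Y \<and> \<eta> > 0 \<and>
    {w. \<forall>f\<in>F. \<bar>blinfun_apply f (w - x)\<bar> < \<eta>} \<subseteq> U"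
proof -
  have "generate_topology_on (insert UNIV {blinfun_apply f -` U |f U. f \<in> Y \<and> open U}) U"
    using assms(1) unfolding sigma_topology_def openin_topology_generated_by_iff .
  then show ?thesis using assms(2)
  proof (induction rule: generate_topology_on.induct)
    case Empty
    then show ?case by simp
  next
    case (Int a b)
    obtain F \<eta> where 1: "finite F" "F \<subseteq> Y" "\<eta> > 0"
      "{w. \<forall>f\<in>F. \<bar>blinfun_apply f (w - x)\<bar> < \<eta>} \<subseteq> a"
      using Int by auto
    obtain G \<theta> where 2: "finite G" "G \<subseteq> Y" "\<theta> > 0"
      "{w. \<forall>f\<in>G. \<bar>blinfun_apply f (w - x)\<bar> < \<theta>} \<subseteq> b"
      using Int by auto
    have "{w. \<forall>f\<in>F \<union> G. \<bar>blinfun_apply f (w - x)\<bar> < min \<eta> \<theta>} \<subseteq> a \<inter> b"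
      using 1(4) 2(4) by auto
    then show ?case using 1 2
      by (intro exI[of _ "F \<union> G"] exI[of _ "min \<eta> \<theta>"]) auto
  next
    case (UN K)
    then obtain k where "k \<in> K" "x \<in> k" by auto
    with UN.IH[OF this] show ?case by (meson Union_upper subset_trans)
  next
    case (Basis s)
    then consider "s = UNIV" | f V where "f \<in> Y" "open V" "s = blinfun_apply f -` V"
      by auto
    then show ?case
    proof cases
      case 1
      then show ?thesis by (intro exI[of _ "{}"] exI[of _ 1]) auto
    next
      case 2
      have "blinfun_apply f x \<in> V" using 2 Basis by auto
      then obtain e where e: "e > 0" "\<And>t. dist t (blinfun_apply f x) < e \<Longrightarrow> t \<in> V"
        using 2(2) unfolding open_dist by blast
      show ?thesis
        using 2 e by (intro exI[of _ "{f}"] exI[of _ e]) (auto simp: dist_real_def blinfun.diff_right)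
    qed
  qed
qed

lemma topcontinuous_at_sigma_iff:
  fixes x :: "'a::real_normed_vector" and g :: "'a \<Rightarrow> 'b::metric_space"
  shows "topcontinuous_at (subtopology (sigma_topology Y) S) euclidean g x \<longleftrightarrow>
    x \<in> S \<and> (\<forall>e>0. \<exists>F \<eta>. finite F \<and> F \<subseteq> Y \<and> \<eta> > 0 \<and>
      (\<forall>w\<in>S. (\<forall>f\<in>F. \<bar>blinfun_apply f (w - x)\<bar> < \<eta>) \<longrightarrow> dist (g w) (g x) < e))"
    (is "?L \<longleftrightarrow> x \<in> S \<and> ?R")
proof (intro iffI conjI)
  assume L: ?L
  then show "x \<in> S" by (simp add: topcontinuous_at_def)
  show ?R
  proof (intro allI impI)
    fix e :: real assume "e > 0"
    then have "openin euclidean (ball (g x) e) \<and> g x \<in> ball (g x) e" by simp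
    with L have "\<exists>U. openin (subtopology (sigma_topology Y) S) U \<and> x \<in> U \<and>
        (\<forall>y\<in>U. g y \<in> ball (g x) e)"
      unfolding topcontinuous_at_def by meson
    then obtain U where U: "openin (subtopology (sigma_topology Y) S) U" "x \<in> U"
      "\<And>y. y \<in> U \<Longrightarrow> g y \<in> ball (g x) e"
      by blast
    obtain T where T: "openin (sigma_topology Y) T" "U = T \<inter> S"
      using U(1) by (auto simp: openin_subtopology)
    have "x \<in> T" using U(2) T(2) by simp
    from openin_sigma_topology_contains_strip[OF T(1) this]
    obtain F \<eta> where F: "finite F" "F \<subseteq> Y" "\<eta> > 0"
      "{w. \<forall>f\<in>F. \<bar>blinfun_apply f (w - x)\<bar> < \<eta>} \<subseteq> T"
      by (elim exE conjE)
    have "dist (g w) (g x) < e" if "w \<in> S" "\<forall>f\<in>F. \<bar>blinfun_apply f (w - x)\<bar> < \<eta>" for w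
    proof -
      have "w \<in> U" using F(4) T(2) that by blast
      then show ?thesis using U(3)[of w] by (simp add: dist_commute)
    qed
    with F(1-3) show "\<exists>F \<eta>. finite F \<and> F \<subseteq> Y \<and> \<eta> > 0 \<and>
      (\<forall>w\<in>S. (\<forall>f\<in>F. \<bar>blinfun_apply f (w - x)\<bar> < \<eta>) \<longrightarrow> dist (g w) (g x) < e)"
      by (intro exI[of _ F] exI[of _ \<eta>] conjI ballI impI)
  qed
next
  assume R: "x \<in> S \<and> ?R"
  show ?L
    unfolding topcontinuous_at_def
  proof (intro conjI allI impI)
    fix V assume "openin euclidean V \<and> g x \<in> V"
    then have "open V" "g x \<in> V" by auto
    then obtain e where e: "e > 0" "\<And>t. dist t (g x) < e \<Longrightarrow> t \<in> V"
      unfolding open_dist by blast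
    obtain F \<eta> where F: "finite F" "F \<subseteq> Y" "\<eta> > 0"
      "\<And>w. w \<in> S \<Longrightarrow> (\<forall>f\<in>F. \<bar>blinfun_apply f (w - x)\<bar> < \<eta>) \<Longrightarrow> dist (g w) (g x) < e"
      using R e(1) by metis
    define U where "U = {w. \<forall>f\<in>F. \<bar>blinfun_apply f (w - x)\<bar> < \<eta>} \<inter> S"
    have "openin (subtopology (sigma_topology Y) S) U"
      using openin_sigma_topology_strip[OF F(1,2)] by (auto simp: U_def openin_subtopology)
    moreover have "x \<in> U" "\<forall>y\<in>U. g y \<in> V"
      using F R e unfolding U_def by auto
    ultimately show "\<exists>U. openin (subtopology (sigma_topology Y) S) U \<and> x \<in> U \<and> (\<forall>y\<in>U. g y \<in> V)"
      by blast
  qed (use R in auto)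
qed

lemma topcontinuous_at_sigmaE:
  fixes x :: "'a::real_normed_vector" and g :: "'a \<Rightarrow> 'b::metric_space"
  assumes "topcontinuous_at (subtopology (sigma_topology Y) S) euclidean g x" "e > 0"
  obtains F and \<eta> :: real where "finite F" "F \<subseteq> Y" "\<eta> > 0"
    "\<And>w. w \<in> S \<Longrightarrow> (\<forall>f\<in>F. \<bar>blinfun_apply f (w - x)\<bar> < \<eta>) \<Longrightarrow> dist (g w) (g x) < e"
proof -
  have "\<exists>F \<eta>. finite F \<and> F \<subseteq> Y \<and> \<eta> > 0 \<and>
      (\<forall>w\<in>S. (\<forall>f\<in>F. \<bar>blinfun_apply f (w - x)\<bar> < \<eta>) \<longrightarrow> dist (g w) (g x) < e)"
    using assms(2)
    by (rule assms(1)[unfolded topcontinuous_at_sigma_iff, THEN conjunct2, THEN spec, THEN mp])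
  then obtain F and \<eta> :: real where F: "finite F" "F \<subseteq> Y" "\<eta> > 0"
    "\<forall>w\<in>S. (\<forall>f\<in>F. \<bar>blinfun_apply f (w - x)\<bar> < \<eta>) \<longrightarrow> dist (g w) (g x) < e"
    by (elim exE conjE)
  show ?thesis by (rule that[OF F(1-3) F(4)[THEN bspec, THEN mp]])
qed

section \<open>Points of continuity\<close>

text \<open>Linear elimination, one functional at a time. If the operator
  \<open>u \<mapsto> u - (\<Sum>f\<in>F. f u *\<^sub>R b f)\<close> is not zero, its
  nonzero values are common zeros of \<open>F\<close>; if it is zero, every vector is recovered from its values
  under \<open>F\<close>. This is the dichotomy of the next lemma.\<close>

lemma finite_functionals_kernel_projection:
  fixes F :: "('a::real_normed_vector \<Rightarrow>\<^sub>L real) set"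
  assumes "finite F"
  shows "\<exists>b :: _ \<Rightarrow> 'a. \<forall>g\<in>F. \<forall>u. blinfun_apply g (u - (\<Sum>f\<in>F. blinfun_apply f u *\<^sub>R b f)) = 0"
  using assms
proof (induction F)
  case empty
  show ?case by simp
next
  case (insert h F)
  then obtain b :: "_ \<Rightarrow> 'a" where
    b: "\<And>g u. g \<in> F \<Longrightarrow> blinfun_apply g (u - (\<Sum>f\<in>F. blinfun_apply f u *\<^sub>R b f)) = 0"
    by blast
  define Q where "Q u = u - (\<Sum>f\<in>F. blinfun_apply f u *\<^sub>R b f)" for u
  show ?case
  proof (cases "\<forall>u. blinfun_apply h (Q u) = 0")
    case True
    \<comment> \<open>On the common kernel of \<open>F\<close> the new functional vanishes, so its vector may be \<open>0\<close>.\<close>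
    have "(\<Sum>f\<in>insert h F. blinfun_apply f u *\<^sub>R (b(h := 0)) f) =
        (\<Sum>f\<in>F. blinfun_apply f u *\<^sub>R b f)" for u
      using insert.hyps by (auto intro!: sum.cong)
    then show ?thesis
      using b True unfolding Q_def by (intro exI[of _ "b(h := 0)"]) auto
  next
    case False
    then obtain v where v: "blinfun_apply h (Q v) \<noteq> 0" by blast
    define k where "k = (1 / blinfun_apply h (Q v)) *\<^sub>R Q v"
    have hk: "blinfun_apply h k = 1" using v by (simp add: k_def blinfun.scaleR_right)
    have gk: "blinfun_apply g k = 0" if "g \<in> F" for g
      using b[OF that, of v] by (simp add: k_def blinfun.scaleR_right Q_def)
    define c where "c = (\<lambda>f. if f = h then k else b f - blinfun_apply h (b f) *\<^sub>R k)"
    \<comment> \<open>The new operator subtracts from \<open>Q u\<close> its component along \<open>k\<close>.\<close>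
    have "u - (\<Sum>f\<in>insert h F. blinfun_apply f u *\<^sub>R c f) = Q u - blinfun_apply h (Q u) *\<^sub>R k" for u
    proof -
      have "(\<Sum>f\<in>F. blinfun_apply f u *\<^sub>R c f) =
          (\<Sum>f\<in>F. blinfun_apply f u *\<^sub>R b f - (blinfun_apply f u * blinfun_apply h (b f)) *\<^sub>R k)"
        using insert.hyps by (intro sum.cong) (auto simp: c_def scaleR_diff_right)
      also have "\<dots> = (\<Sum>f\<in>F. blinfun_apply f u *\<^sub>R b f) -
          (\<Sum>f\<in>F. blinfun_apply f u * blinfun_apply h (b f)) *\<^sub>R k"
        by (simp add: sum_subtractf scaleR_left.sum)
      finally show ?thesis
        using insert.hyps
        by (simp add: c_def Q_def blinfun.diff_right blinfun.sum_right blinfun.scaleR_right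
            algebra_simps)
    qed
    moreover have "blinfun_apply g (Q u - blinfun_apply h (Q u) *\<^sub>R k) = 0"
      if "g \<in> insert h F" for g u
    proof (cases "g = h")
      case True
      then show ?thesis using hk by (simp add: blinfun.diff_right blinfun.scaleR_right)
    next
      case False
      then have "blinfun_apply g (Q u) = 0" "blinfun_apply g k = 0"
        using that b gk by (auto simp: Q_def)
      then show ?thesis by (simp add: blinfun.diff_right blinfun.scaleR_right)
    qed
    ultimately show ?thesis by (intro exI[of _ c] ballI allI) (simp only:)
  qed
qed

lemma common_kernel_or_norm_bound:
  fixes F :: "('a::real_normed_vector \<Rightarrow>\<^sub>L real) set"
  assumes "finite F"
  obtains k where "k \<noteq> 0" "\<And>f. f \<in> F \<Longrightarrow> blinfun_apply f k = 0"
  | C where "C > 0" "\<And>u \<delta>. (\<And>f. f \<in> F \<Longrightarrow> \<bar>blinfun_apply f u\<bar> \<le> \<delta>) \<Longrightarrow> norm u \<le> C * \<bar>\<delta>\<bar>"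
proof -
  obtain b :: "_ \<Rightarrow> 'a" where
    b: "\<And>g u. g \<in> F \<Longrightarrow> blinfun_apply g (u - (\<Sum>f\<in>F. blinfun_apply f u *\<^sub>R b f)) = 0"
    using finite_functionals_kernel_projection[OF assms] by blast
  show ?thesis
  proof (cases "\<forall>u. u - (\<Sum>f\<in>F. blinfun_apply f u *\<^sub>R b f) = 0")
    case True
    define C where "C = 1 + (\<Sum>f\<in>F. norm (b f))"
    have "C > 0" unfolding C_def by (intro add_pos_nonneg sum_nonneg) auto
    moreover have "norm u \<le> C * \<bar>\<delta>\<bar>" if d: "\<And>f. f \<in> F \<Longrightarrow> \<bar>blinfun_apply f u\<bar> \<le> \<delta>" for u \<delta>
    proof -
      have "norm u = norm (\<Sum>f\<in>F. blinfun_apply f u *\<^sub>R b f)" using True by (metis right_minus_eq)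
      also have "\<dots> \<le> (\<Sum>f\<in>F. \<bar>\<delta>\<bar> * norm (b f))"
      proof (intro sum_norm_le)
        fix f assume "f \<in> F"
        then show "norm (blinfun_apply f u *\<^sub>R b f) \<le> \<bar>\<delta>\<bar> * norm (b f)"
          using d[of f] by (simp add: mult_right_mono)
      qed
      also have "\<dots> \<le> C * \<bar>\<delta>\<bar>"
        by (simp add: C_def sum_distrib_left[symmetric] algebra_simps)
      finally show ?thesis .
    qed
    ultimately show ?thesis using that(2) by blast
  next
    case False
    then show ?thesis using b that(1) by blast
  qed
qed

lemma ray_meets_unit_sphere:
  fixes u k :: "'a::real_normed_vector"
  assumes "norm u \<le> 1" "k \<noteq> 0"
  obtains t where "t \<ge> 0" "norm (u + t *\<^sub>R k) = 1"
proof -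
  have "norm (u + (2 / norm k) *\<^sub>R k) \<ge> 1"
    using norm_triangle_ineq2[of "(2 / norm k) *\<^sub>R k" "- u"] assms by (simp add: add.commute)
  moreover have "continuous_on {0..2 / norm k} (\<lambda>t. norm (u + t *\<^sub>R k))"
    by (intro continuous_intros)
  ultimately show ?thesis
    using IVT'[of "\<lambda>t. norm (u + t *\<^sub>R k)" 0 1 "2 / norm k"] assms that by auto
qed

text \<open>The reason that the sphere alone decides: along a common zero of the functionals, a point of the
  ball lies between two points of the sphere that the functionals cannot tell from it, and \<open>\<theta> = \<eta>\<close>
  works. Only when the functionals have no common zero but \<open>0\<close> does the strip have to shrink; it
  is then small in norm by itself, whether or not it meets the sphere.\<close>

lemma strip_small_on_sphere_imp_small_on_ball:
  fixes F :: "('a::real_normed_vector \<Rightarrow>\<^sub>L real) set" and \<eta> e :: real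
  assumes "finite F" "\<eta> > 0" "e > 0"
    and small: "\<And>w. norm w = 1 \<Longrightarrow> (\<forall>f\<in>F. \<bar>blinfun_apply f (w - x)\<bar> < \<eta>) \<Longrightarrow> dist w x < e"
  shows "\<exists>\<theta>>0. \<forall>u\<in>cball 0 1. (\<forall>f\<in>F. \<bar>blinfun_apply f (u - x)\<bar> < \<theta>) \<longrightarrow> dist u x < e"
proof (cases rule: common_kernel_or_norm_bound[OF \<open>finite F\<close>])
  case (1 k)
  have "dist u x < e" if u: "norm u \<le> 1" "\<forall>f\<in>F. \<bar>blinfun_apply f (u - x)\<bar> < \<eta>" for u
  proof -
    obtain t where t: "t \<ge> 0" "norm (u + t *\<^sub>R k) = 1"
      using ray_meets_unit_sphere[OF u(1) 1(1)] .
    obtain s where s: "s \<ge> 0" "norm (u + s *\<^sub>R (- k)) = 1"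
      using ray_meets_unit_sphere[OF u(1), of "- k"] 1(1) by auto
    have "u + t *\<^sub>R k \<in> ball x e" "u + s *\<^sub>R (- k) \<in> ball x e"
      using small[OF t(2)] small[OF s(2)] u(2) 1(2)
      by (auto simp: dist_commute blinfun.diff_right blinfun.add_right blinfun.scaleR_right
          blinfun.minus_right)
    moreover have "u \<in> closed_segment (u + t *\<^sub>R k) (u + s *\<^sub>R (- k))"
    proof (cases "t + s = 0")
      case True
      then have "t = 0" using t s by auto
      then show ?thesis by simp
    next
      case False
      have "(1 - t / (t + s)) *\<^sub>R (u + t *\<^sub>R k) + (t / (t + s)) *\<^sub>R (u + s *\<^sub>R (- k)) =
          u + ((1 - t / (t + s)) * t - t / (t + s) * s) *\<^sub>R k"
        by (simp add: algebra_simps)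
      also have "(1 - t / (t + s)) * t - t / (t + s) * s = 0"
        using False by (simp add: field_simps)
      finally show ?thesis
        using t(1) s(1) False unfolding in_segment
        by (intro exI[of _ "t / (t + s)"]) (auto simp: divide_simps)
    qed
    ultimately have "u \<in> ball x e"
      using closed_segment_subset[OF _ _ convex_ball] by blast
    then show ?thesis by (simp add: dist_commute)
  qed
  then show ?thesis using \<open>\<eta> > 0\<close> by (intro exI[of _ \<eta>]) auto
next
  case (2 C)
  have "dist u x < e" if "\<forall>f\<in>F. \<bar>blinfun_apply f (u - x)\<bar> < e / (2 * C)" for u
  proof -
    have "norm (u - x) \<le> C * \<bar>e / (2 * C)\<bar>"
      using that by (intro 2(2)) (auto intro: less_imp_le)
    also have "\<dots> < e" using 2(1) \<open>e > 0\<close> by (simp add: abs_if)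
    finally show ?thesis by (simp add: dist_norm)
  qed
  then show ?thesis using \<open>e > 0\<close> 2(1) by (intro exI[of _ "e / (2 * C)"]) auto
qed

lemma rescale_into_unit_ball:
  fixes N :: "'a::real_normed_vector \<Rightarrow> real"
  assumes "equivalent_norm N" "norm s = 1"
  shows "N ((1 / max 1 (N s)) *\<^sub>R s) \<le> 1"
    and "norm (s - (1 / max 1 (N s)) *\<^sub>R s) \<le> max 1 (N s) - 1"
proof -
  define c where "c = max 1 (N s)"
  have c: "c \<ge> 1" "N s \<le> c" by (auto simp: c_def)
  have "N ((1 / c) *\<^sub>R s) = N s / c"
    using assms c unfolding equivalent_norm_def by simp
  then show "N ((1 / max 1 (N s)) *\<^sub>R s) \<le> 1"
    using c unfolding c_def[symmetric] by simp
  have "s - (1 / c) *\<^sub>R s = (1 - 1 / c) *\<^sub>R s" by (simp add: algebra_simps)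
  then have "norm (s - (1 / c) *\<^sub>R s) = 1 - 1 / c" using c assms(2) by simp
  also have "\<dots> = (c - 1) / c" using c by (simp add: field_simps)
  also have "\<dots> \<le> (c - 1) / 1" using c by (intro divide_left_mono) auto
  finally show "norm (s - (1 / max 1 (N s)) *\<^sub>R s) \<le> max 1 (N s) - 1"
    unfolding c_def[symmetric] by simp
qed

lemma point_of_continuity_transfer:
  fixes N :: "'a::real_normed_vector \<Rightarrow> real"
  assumes N: "equivalent_norm N" and x: "norm x = 1"
    and cont: "topcontinuous_at (subtopology weak_topology (sphere 0 1)) euclideanreal N x"
    and pc: "point_of_continuity x {u. N u \<le> 1}"
  shows "point_of_continuity x (cball 0 1)"
  unfolding point_of_continuity_def topcontinuous_at_sigma_iff
proof (intro conjI allI impI)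
  show "x \<in> cball 0 1" using x by simp
  fix e :: real assume e: "e > 0"
  have "x \<in> {u. N u \<le> 1}"
    using pc unfolding point_of_continuity_def topcontinuous_at_sigma_iff by (rule conjunct1)
  then have Nx: "N x \<le> 1" by simp
  obtain F and \<eta> :: real where F: "finite F" "\<eta> > 0"
    "\<And>w. N w \<le> 1 \<Longrightarrow> (\<forall>f\<in>F. \<bar>blinfun_apply f (w - x)\<bar> < \<eta>) \<Longrightarrow> dist w x < e / 2"
    using topcontinuous_at_sigmaE[OF pc[unfolded point_of_continuity_def] half_gt_zero[OF e]]
    unfolding mem_Collect_eq by metis
  \<comment> \<open>A move of norm at most \<open>\<delta>\<close> changes the values of the functionals in \<open>F\<close> by less than \<open>\<eta> / 2\<close>
    and distances by at most \<open>e / 2\<close>.\<close>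
  define K where "K = 1 + (\<Sum>f\<in>F. norm f)"
  have K: "norm f < K" if "f \<in> F" for f
    using member_le_sum[OF that, of norm] F(1) unfolding K_def by simp
  have K0: "K > 0" unfolding K_def by (intro add_pos_nonneg sum_nonneg) auto
  define \<delta> where "\<delta> = min (e / 2) (\<eta> / (2 * K))"
  have d: "\<delta> > 0" "\<delta> \<le> e / 2" "K * \<delta> \<le> \<eta> / 2"
  proof -
    show "\<delta> > 0" "\<delta> \<le> e / 2" using e F(2) K0 by (auto simp: \<delta>_def)
    have "K * \<delta> \<le> K * (\<eta> / (2 * K))" using K0 by (intro mult_left_mono) (auto simp: \<delta>_def)
    then show "K * \<delta> \<le> \<eta> / 2" using K0 by simp
  qed
  obtain G and \<theta> :: real where G: "finite G" "\<theta> > 0"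
    "\<And>w. norm w = 1 \<Longrightarrow> (\<forall>f\<in>G. \<bar>blinfun_apply f (w - x)\<bar> < \<theta>) \<Longrightarrow> dist (N w) (N x) < \<delta>"
    using topcontinuous_at_sigmaE[OF cont d(1)] unfolding mem_sphere_0 by metis
  have small: "dist w x < e" if w: "norm w = 1"
    "\<forall>f\<in>F \<union> G. \<bar>blinfun_apply f (w - x)\<bar> < min (\<eta> / 2) \<theta>" for w
  proof -
    define v where "v = (1 / max 1 (N w)) *\<^sub>R w"
    have "dist (N w) (N x) < \<delta>" using G(3)[OF w(1)] w(2) by auto
    then have "max 1 (N w) - 1 \<le> \<delta>" using Nx d(1) by (auto simp: dist_real_def)
    then have wv: "norm (w - v) \<le> \<delta>"
      using rescale_into_unit_ball(2)[OF N w(1)] unfolding v_def by linarith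
    have "\<bar>blinfun_apply f (v - x)\<bar> < \<eta>" if f: "f \<in> F" for f
    proof -
      have "\<bar>blinfun_apply f (v - x)\<bar> \<le> \<bar>blinfun_apply f (w - x)\<bar> + \<bar>blinfun_apply f (w - v)\<bar>"
        by (simp add: blinfun.diff_right)
      moreover have "\<bar>blinfun_apply f (w - v)\<bar> \<le> norm f * norm (w - v)"
        using norm_blinfun[of f "w - v"] by simp
      moreover have "norm f * norm (w - v) \<le> K * \<delta>"
        using K[OF f] wv K0 by (intro mult_mono) auto
      moreover have "\<bar>blinfun_apply f (w - x)\<bar> < \<eta> / 2" using w(2) f by simp
      ultimately show ?thesis using d(3) by linarith
    qed
    moreover have "N v \<le> 1" unfolding v_def by (rule rescale_into_unit_ball(1)[OF N w(1)])
    ultimately have "dist v x < e / 2" by (intro F(3)) auto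
    then show ?thesis
      using wv d(2) dist_triangle[of w x v] by (simp add: dist_norm)
  qed
  obtain \<zeta> :: real where z: "\<zeta> > 0" and zsmall:
    "\<forall>u\<in>cball 0 1. (\<forall>f\<in>F \<union> G. \<bar>blinfun_apply f (u - x)\<bar> < \<zeta>) \<longrightarrow> dist u x < e"
    using strip_small_on_sphere_imp_small_on_ball[of "F \<union> G" "min (\<eta> / 2) \<theta>" e x]
      small F(1,2) G(1,2) e by auto
  show "\<exists>F (\<eta>::real). finite F \<and> F \<subseteq> UNIV \<and> \<eta> > 0 \<and>
      (\<forall>w\<in>cball 0 1. (\<forall>f\<in>F. \<bar>blinfun_apply f (w - x)\<bar> < \<eta>) \<longrightarrow> dist w x < e)"
    by (intro exI[of _ "F \<union> G"] exI[of _ \<zeta>] conjI finite_UnI F(1) G(1) z zsmall subset_UNIV)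
qed

section \<open>Strongly extreme points\<close>

lemma topcontinuous_at_sigma_sequentially:
  fixes x :: "'a::real_normed_vector" and g :: "'a \<Rightarrow> 'b::metric_space"
  assumes cont: "topcontinuous_at (subtopology (sigma_topology Y) S) euclidean g x"
    and s: "\<And>n. s n \<in> S"
    and conv: "\<And>f. f \<in> Y \<Longrightarrow> (\<lambda>n. blinfun_apply f (s n)) \<longlonglongrightarrow> blinfun_apply f x"
  shows "(\<lambda>n. g (s n)) \<longlonglongrightarrow> g x"
proof (rule tendstoI)
  fix e :: real assume "e > 0"
  then obtain F and \<eta> :: real where F: "finite F" "F \<subseteq> Y" "\<eta> > 0"
    "\<And>w. w \<in> S \<Longrightarrow> (\<forall>f\<in>F. \<bar>blinfun_apply f (w - x)\<bar> < \<eta>) \<Longrightarrow> dist (g w) (g x) < e"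
    using topcontinuous_at_sigmaE[OF cont] by metis
  have "\<forall>\<^sub>F n in sequentially. \<forall>f\<in>F. \<bar>blinfun_apply f (s n - x)\<bar> < \<eta>"
    using F(1)
  proof (rule eventually_ball_finite, intro ballI)
    fix f assume "f \<in> F"
    then show "\<forall>\<^sub>F n in sequentially. \<bar>blinfun_apply f (s n - x)\<bar> < \<eta>"
      using tendstoD[OF conv[of f] F(3)] F(2) by (auto simp: dist_real_def blinfun.diff_right)
  qed
  then show "\<forall>\<^sub>F n in sequentially. dist (g (s n)) (g x) < e"
    by eventually_elim (use F(4) s in blast)
qed

lemma sigma_near_sphere_approximable_in_ball:
  fixes N :: "'a::real_normed_vector \<Rightarrow> real"
  assumes N: "equivalent_norm N" and x: "norm x = 1" and Nx: "N x \<le> 1"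
    and cont: "topcontinuous_at (subtopology (sigma_topology Y) (sphere 0 1)) euclideanreal N x"
    and p: "(\<lambda>n. norm (p n)) \<longlonglongrightarrow> 1"
    and conv: "\<And>f. f \<in> Y \<Longrightarrow> (\<lambda>n. blinfun_apply f (p n)) \<longlonglongrightarrow> blinfun_apply f x"
  obtains v where "\<And>n. N (v n) \<le> 1" "(\<lambda>n. p n - v n) \<longlonglongrightarrow> 0"
proof -
  \<comment> \<open>The value at \<open>0\<close> only matters for finitely many indices; any unit vector would do.\<close>
  define s where "s n = (if p n = 0 then x else sgn (p n))" for n
  have s: "norm (s n) = 1" for n using x by (simp add: s_def norm_sgn)
  have "norm (p n - s n) = \<bar>norm (p n) - 1\<bar>" for n
  proof (cases "p n = 0")
    case False
    have "p n - s n = (norm (p n) - 1) *\<^sub>R sgn (p n)"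
      using False by (simp add: s_def sgn_div_norm algebra_simps)
    then show ?thesis using False by (simp add: norm_sgn)
  qed (simp add: s_def x)
  moreover have "(\<lambda>n. \<bar>norm (p n) - 1\<bar>) \<longlonglongrightarrow> 0"
    using tendsto_rabs[OF tendsto_diff[OF p tendsto_const[of 1]]] by simp
  ultimately have ps: "(\<lambda>n. p n - s n) \<longlonglongrightarrow> 0"
    by (subst tendsto_norm_zero_iff[symmetric]) simp
  have "(\<lambda>n. blinfun_apply f (s n)) \<longlonglongrightarrow> blinfun_apply f x" if "f \<in> Y" for f
    using tendsto_diff[OF conv[OF that] blinfun.tendsto[OF tendsto_const[of f] ps]]
    by (simp add: blinfun.diff_right)
  then have "(\<lambda>n. N (s n)) \<longlonglongrightarrow> N x"
    using s by (intro topcontinuous_at_sigma_sequentially[OF cont]) auto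
  then have "(\<lambda>n. max 1 (N (s n)) - 1) \<longlonglongrightarrow> max 1 (N x) - 1"
    by (intro tendsto_intros)
  then have c: "(\<lambda>n. max 1 (N (s n)) - 1) \<longlonglongrightarrow> 0" using Nx by simp
  define v where "v n = (1 / max 1 (N (s n))) *\<^sub>R s n" for n
  have "(\<lambda>n. s n - v n) \<longlonglongrightarrow> 0"
    using rescale_into_unit_ball(2)[OF N s] unfolding v_def
    by (intro Lim_null_comparison[OF _ c] always_eventually) blast
  then have "(\<lambda>n. p n - v n) \<longlonglongrightarrow> 0"
    using tendsto_add[OF ps] by fastforce
  then show ?thesis
    using that[of v] rescale_into_unit_ball(1)[OF N s] unfolding v_def by blast
qed

lemma midpoints_to_sphere_imp_norm_tendsto_1:
  fixes p q :: "nat \<Rightarrow> 'a::real_normed_vector"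
  assumes "norm x = 1" "\<And>n. norm (p n) \<le> 1" "\<And>n. norm (q n) \<le> 1"
    and mid: "(\<lambda>n. (1/2) *\<^sub>R (p n + q n)) \<longlonglongrightarrow> x"
  shows "(\<lambda>n. norm (p n)) \<longlonglongrightarrow> 1"
proof (rule tendsto_sandwich)
  show "\<forall>\<^sub>F n in sequentially. 2 * norm ((1/2) *\<^sub>R (p n + q n)) - 1 \<le> norm (p n)"
  proof (intro always_eventually allI)
    fix n
    show "2 * norm ((1/2) *\<^sub>R (p n + q n)) - 1 \<le> norm (p n)"
      using norm_triangle_ineq[of "p n" "q n"] assms(3)[of n] by simp
  qed
  have "(\<lambda>n. 2 * norm ((1/2) *\<^sub>R (p n + q n)) - 1) \<longlonglongrightarrow> 2 * norm x - 1"
    by (intro tendsto_intros mid)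
  then show "(\<lambda>n. 2 * norm ((1/2) *\<^sub>R (p n + q n)) - 1) \<longlonglongrightarrow> 1" using assms(1) by simp
qed (use assms in auto)

text \<open>Both sequences are within a vanishing norm distance of sequences in the unit ball of \<open>N\<close>, so
  strong extremality in that ball applies to them. Convergence of \<open>q\<close> in \<open>\<sigma>\<close> follows from that of
  \<open>p\<close> and of the midpoints.\<close>

lemma sigma_near_midpoints_collapse:
  fixes N :: "'a::real_normed_vector \<Rightarrow> real"
  assumes N: "equivalent_norm N" and x: "norm x = 1"
    and cont: "topcontinuous_at (subtopology (sigma_topology Y) (sphere 0 1)) euclideanreal N x"
    and se: "strongly_extreme_point x {u. N u \<le> 1}"
    and p: "\<And>n. norm (p n) \<le> 1" and q: "\<And>n. norm (q n) \<le> 1"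
    and mid: "(\<lambda>n. (1/2) *\<^sub>R (p n + q n)) \<longlonglongrightarrow> x"
    and conv: "\<And>f. f \<in> Y \<Longrightarrow> (\<lambda>n. blinfun_apply f (p n)) \<longlonglongrightarrow> blinfun_apply f x"
  shows "(\<lambda>n. p n - q n) \<longlonglongrightarrow> 0"
proof -
  have Nx: "N x \<le> 1" using se by (simp add: strongly_extreme_point_def)
  have mid': "(\<lambda>n. (1/2) *\<^sub>R (q n + p n)) \<longlonglongrightarrow> x" using mid by (simp add: add.commute)
  have convq: "(\<lambda>n. blinfun_apply f (q n)) \<longlonglongrightarrow> blinfun_apply f x" if "f \<in> Y" for f
  proof -
    have "(\<lambda>n. 2 * blinfun_apply f ((1/2) *\<^sub>R (p n + q n)) - blinfun_apply f (p n))
        \<longlonglongrightarrow> 2 * blinfun_apply f x - blinfun_apply f x"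
      by (intro tendsto_intros mid conv that)
    then show ?thesis
      by (simp add: blinfun.scaleR_right blinfun.add_right add_divide_distrib)
  qed
  obtain v where v: "\<And>n. N (v n) \<le> 1" "(\<lambda>n. p n - v n) \<longlonglongrightarrow> 0"
    using sigma_near_sphere_approximable_in_ball[OF N x Nx cont
        midpoints_to_sphere_imp_norm_tendsto_1[OF x p q mid] conv] by blast
  obtain w where w: "\<And>n. N (w n) \<le> 1" "(\<lambda>n. q n - w n) \<longlonglongrightarrow> 0"
    using sigma_near_sphere_approximable_in_ball[OF N x Nx cont
        midpoints_to_sphere_imp_norm_tendsto_1[OF x q p mid'] convq] by blast
  have "(\<lambda>n. norm (x - ((1/2) *\<^sub>R (p n + q n) - (1/2) *\<^sub>R ((p n - v n) + (q n - w n)))))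
      \<longlonglongrightarrow> norm (x - (x - (1/2) *\<^sub>R (0 + 0)))"
    by (intro tendsto_intros mid v w)
  moreover have "(1/2) *\<^sub>R (p n + q n) - (1/2) *\<^sub>R ((p n - v n) + (q n - w n)) =
      (1/2) *\<^sub>R (v n + w n)" for n
    by (simp add: algebra_simps)
  ultimately have "(\<lambda>n. norm (x - (1/2) *\<^sub>R (v n + w n))) \<longlonglongrightarrow> 0" by simp
  then have "(\<lambda>n. norm (v n - w n)) \<longlonglongrightarrow> 0"
    using se v(1) w(1) unfolding strongly_extreme_point_def by blast
  then have "(\<lambda>n. v n - w n) \<longlonglongrightarrow> 0" by (rule tendsto_norm_zero_cancel)
  from tendsto_diff[OF tendsto_add[OF v(2) this] w(2)]
  show ?thesis by simp
qed

lemma midpoint_differences_Cauchy: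
  fixes N :: "'a::real_normed_vector \<Rightarrow> real"
  assumes N: "equivalent_norm N" and x: "norm x = 1"
    and cont: "topcontinuous_at (subtopology (sigma_topology Y) (sphere 0 1)) euclideanreal N x"
    and se: "strongly_extreme_point x {u. N u \<le> 1}"
    and y: "\<And>n. norm (y n) \<le> 1" and z: "\<And>n. norm (z n) \<le> 1"
    and mid: "(\<lambda>n. (1/2) *\<^sub>R (y n + z n)) \<longlonglongrightarrow> x"
    and yC: "sigma_Cauchy Y y"
  shows "Cauchy (\<lambda>n. y n - z n)"
proof (rule ccontr)
  assume "\<not> ?thesis"
  then obtain e where e: "e > 0"
    "\<not> (\<exists>k. \<forall>m\<ge>k. \<forall>n\<ge>k. dist (y m - z m) (y n - z n) < e)"
    unfolding Cauchy_def by blast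
  then have "\<forall>k. \<exists>n m. n \<ge> k \<and> m \<ge> k \<and> \<not> dist (y m - z m) (y n - z n) < e"
    by blast
  then obtain a b where ab: "\<And>k. a k \<ge> k" "\<And>k. b k \<ge> k"
    "\<And>k. \<not> dist (y (b k) - z (b k)) (y (a k) - z (a k)) < e"
    by metis
  have lim: "filterlim a sequentially sequentially" "filterlim b sequentially sequentially"
    using filterlim_at_top_mono[OF filterlim_ident] ab(1,2) by (auto intro: always_eventually)
  \<comment> \<open>Crossing the indices keeps the midpoint of \<open>p k\<close> and \<open>q k\<close> close to \<open>x\<close>, and the gap between
    the two differences becomes the gap between \<open>p k\<close> and \<open>q k\<close>.\<close>
  define p where "p k = (1/2) *\<^sub>R (y (a k) + z (b k))" for k
  define q where "q k = (1/2) *\<^sub>R (y (b k) + z (a k))" for k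
  have half: "norm ((1/2) *\<^sub>R (u + v)) \<le> 1" if "norm u \<le> 1" "norm v \<le> 1" for u v :: 'a
    using norm_triangle_ineq[of u v] that by simp
  have mida: "(\<lambda>k. (1/2) *\<^sub>R (y (a k) + z (a k))) \<longlonglongrightarrow> x"
    using filterlim_compose[OF mid lim(1)] .
  have midb: "(\<lambda>k. (1/2) *\<^sub>R (y (b k) + z (b k))) \<longlonglongrightarrow> x"
    using filterlim_compose[OF mid lim(2)] .
  have "(\<lambda>k. (1/2) *\<^sub>R ((1/2) *\<^sub>R (y (a k) + z (a k)) + (1/2) *\<^sub>R (y (b k) + z (b k))))
      \<longlonglongrightarrow> (1/2) *\<^sub>R (x + x)"
    by (intro tendsto_intros mida midb)
  moreover have "(1/2) *\<^sub>R ((1/2) *\<^sub>R (y (a k) + z (a k)) + (1/2) *\<^sub>R (y (b k) + z (b k))) =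
      (1/2) *\<^sub>R (p k + q k)" for k
    by (simp add: p_def q_def algebra_simps)
  ultimately have midpq: "(\<lambda>k. (1/2) *\<^sub>R (p k + q k)) \<longlonglongrightarrow> x"
    by simp
  have "(\<lambda>k. blinfun_apply f (p k)) \<longlonglongrightarrow> blinfun_apply f x" if "f \<in> Y" for f
  proof -
    have "Cauchy (\<lambda>n. blinfun_apply f (y n))" using yC that by (simp add: sigma_Cauchy_def)
    then obtain l where l: "(\<lambda>n. blinfun_apply f (y n)) \<longlonglongrightarrow> l"
      using Cauchy_convergent_iff convergent_def by blast
    have "(\<lambda>k. blinfun_apply f ((1/2) *\<^sub>R (y (b k) + z (b k))) +
        (blinfun_apply f (y (a k)) - blinfun_apply f (y (b k))) / 2)
        \<longlonglongrightarrow> blinfun_apply f x + (l - l) / 2"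
      by (intro tendsto_intros midb filterlim_compose[OF l lim(1)] filterlim_compose[OF l lim(2)])
         simp
    moreover have "blinfun_apply f ((1/2) *\<^sub>R (y (b k) + z (b k))) +
        (blinfun_apply f (y (a k)) - blinfun_apply f (y (b k))) / 2 = blinfun_apply f (p k)" for k
      by (simp add: p_def blinfun.scaleR_right blinfun.add_right field_simps)
    ultimately show ?thesis by simp
  qed
  then have "(\<lambda>k. p k - q k) \<longlonglongrightarrow> 0"
    using midpq half y z unfolding p_def q_def
    by (intro sigma_near_midpoints_collapse[OF N x cont se]) auto
  from tendstoD[OF this half_gt_zero[OF e(1)]]
  have "\<forall>\<^sub>F k in sequentially. norm (p k - q k) < e / 2"
    by (simp only: dist_norm diff_zero)
  then obtain k where k: "norm (p k - q k) < e / 2"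
    by (meson eventually_sequentially order_refl)
  have "(y (b k) - z (b k)) - (y (a k) - z (a k)) = (-2) *\<^sub>R (p k - q k)"
    by (simp add: p_def q_def scaleR_diff_right scaleR_add_right)
  then have "dist (y (b k) - z (b k)) (y (a k) - z (a k)) = 2 * norm (p k - q k)"
    by (simp only: dist_norm norm_scaleR abs_neg_numeral)
  then show False using ab(3)[of k] k by simp
qed

lemma extreme_point_midpoint_differences_tendsto_0:
  fixes x :: "'a::real_normed_vector"
  assumes ex: "x extreme_point_of (cball 0 1)"
    and y: "\<And>n. norm (y n) \<le> 1" and z: "\<And>n. norm (z n) \<le> 1"
    and mid: "(\<lambda>n. (1/2) *\<^sub>R (y n + z n)) \<longlonglongrightarrow> x"
    and diff: "convergent (\<lambda>n. y n - z n)"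
  shows "(\<lambda>n. y n - z n) \<longlonglongrightarrow> 0"
proof -
  obtain d where d: "(\<lambda>n. y n - z n) \<longlonglongrightarrow> d" using diff convergent_def by blast
  have "(\<lambda>n. (1/2) *\<^sub>R (y n + z n) + (1/2) *\<^sub>R (y n - z n)) \<longlonglongrightarrow> x + (1/2) *\<^sub>R d"
    by (intro tendsto_intros mid d)
  moreover have "(1/2) *\<^sub>R (y n + z n) + (1/2) *\<^sub>R (y n - z n) = y n" for n
    by (simp flip: scaleR_add_right)
  ultimately have "y \<longlonglongrightarrow> x + (1/2) *\<^sub>R d" by simp
  then have yb: "norm (x + (1/2) *\<^sub>R d) \<le> 1"
    using y by (intro tendsto_upperbound[OF tendsto_norm]) auto
  have "(\<lambda>n. (1/2) *\<^sub>R (y n + z n) - (1/2) *\<^sub>R (y n - z n)) \<longlonglongrightarrow> x - (1/2) *\<^sub>R d"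
    by (intro tendsto_intros mid d)
  moreover have "(1/2) *\<^sub>R (y n + z n) - (1/2) *\<^sub>R (y n - z n) = z n" for n
    by (simp flip: scaleR_diff_right)
  ultimately have "z \<longlonglongrightarrow> x - (1/2) *\<^sub>R d" by simp
  then have zb: "norm (x - (1/2) *\<^sub>R d) \<le> 1"
    using z by (intro tendsto_upperbound[OF tendsto_norm]) auto
  have "x = (1/2) *\<^sub>R ((x + (1/2) *\<^sub>R d) + (x - (1/2) *\<^sub>R d))"
    by simp
  then have "x + (1/2) *\<^sub>R d = x"
    using ex yb zb mem_cball_0 unfolding extreme_point_of_midpoint[OF convex_cball] by blast
  then show ?thesis using d by simp
qed

lemma strongly_extreme_point_transfer:
  fixes N :: "'a::banach \<Rightarrow> real"
  assumes N: "equivalent_norm N" and x: "norm x = 1"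
    and cont: "topcontinuous_at (subtopology (sigma_topology Y) (sphere 0 1)) euclideanreal N x"
    and sub: "\<And>u :: nat \<Rightarrow> 'a. bounded (range u) \<Longrightarrow> \<exists>r. strict_mono r \<and> sigma_Cauchy Y (u \<circ> r)"
    and ex: "x extreme_point_of (cball 0 1)"
    and se: "strongly_extreme_point x {u. N u \<le> 1}"
  shows "strongly_extreme_point x (cball 0 1)"
  unfolding strongly_extreme_point_def
proof (intro conjI allI impI)
  show "x \<in> cball 0 1" using x by simp
  fix y z :: "nat \<Rightarrow> 'a"
  assume "range y \<subseteq> cball 0 1" "range z \<subseteq> cball 0 1"
  then have y: "norm (y n) \<le> 1" and z: "norm (z n) \<le> 1" for n
    by (auto simp: image_subset_iff)
  assume "(\<lambda>n. norm (x - (1/2) *\<^sub>R (y n + z n))) \<longlonglongrightarrow> 0"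
  then have "(\<lambda>n. x - (x - (1/2) *\<^sub>R (y n + z n))) \<longlonglongrightarrow> x - 0"
    by (intro tendsto_intros) (rule tendsto_norm_zero_cancel)
  then have mid: "(\<lambda>n. (1/2) *\<^sub>R (y n + z n)) \<longlonglongrightarrow> x" by simp
  show "(\<lambda>n. norm (y n - z n)) \<longlonglongrightarrow> 0"
  proof (rule ccontr)
    assume "\<not> ?thesis"
    then obtain e where e: "e > 0" "\<exists>\<^sub>F n in sequentially. norm (y n - z n) \<ge> e"
      unfolding tendsto_iff frequently_def by (auto simp: not_le)
    then have "infinite {n. norm (y n - z n) \<ge> e}"
      by (simp add: cofinite_eq_sequentially[symmetric] frequently_cofinite)
    then obtain s :: "nat \<Rightarrow> nat" where s: "strict_mono s" "\<And>n. norm (y (s n) - z (s n)) \<ge> e"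
      using infinite_enumerate[of "{n. norm (y n - z n) \<ge> e}"] by auto
    have "bounded (range (y \<circ> s))" using y by (intro boundedI[of _ 1]) auto
    then obtain r where r: "strict_mono r" "sigma_Cauchy Y (y \<circ> s \<circ> r)" using sub by blast
    have "strict_mono (s \<circ> r)" using s(1) r(1) by (rule strict_mono_o)
    then have mid': "(\<lambda>n. (1/2) *\<^sub>R ((y \<circ> s \<circ> r) n + (z \<circ> s \<circ> r) n)) \<longlonglongrightarrow> x"
      using LIMSEQ_subseq_LIMSEQ[OF mid, of "s \<circ> r"] by (simp add: o_def)
    have "Cauchy (\<lambda>n. (y \<circ> s \<circ> r) n - (z \<circ> s \<circ> r) n)"
      by (rule midpoint_differences_Cauchy[OF N x cont se _ _ mid' r(2)]) (auto simp: y z)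
    then have "(\<lambda>n. (y \<circ> s \<circ> r) n - (z \<circ> s \<circ> r) n) \<longlonglongrightarrow> 0"
      using y z mid'
      by (intro extreme_point_midpoint_differences_tendsto_0[OF ex]) (auto simp: Cauchy_convergent_iff)
    from tendstoD[OF this e(1)]
    have "\<forall>\<^sub>F n in sequentially. norm ((y \<circ> s \<circ> r) n - (z \<circ> s \<circ> r) n) < e"
      by (simp only: dist_norm diff_zero)
    then obtain n where "norm ((y \<circ> s \<circ> r) n - (z \<circ> s \<circ> r) n) < e"
      by (meson eventually_sequentially order_refl)
    then show False using s(2)[of "r n"] by simp
  qed
qed

theorem theorem4p1:
  fixes N :: "'a::banach \<Rightarrow> real" and x :: 'a
  assumes "equivalent_norm N"
    and "x \<in> sphere 0 1"
  shows
    "(topcontinuous_at (subtopology weak_topology (sphere 0 1)) euclideanreal N x \<longrightarrow>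
        point_of_continuity x {u. N u \<le> 1} \<longrightarrow>
        point_of_continuity x (cball 0 1)) \<and>
     (\<forall>Y :: ('a \<Rightarrow>\<^sub>L real) set.
        topcontinuous_at (subtopology (sigma_topology Y) (sphere 0 1)) euclideanreal N x \<longrightarrow>
        (\<forall>u :: nat \<Rightarrow> 'a. bounded (range u) \<longrightarrow>
           (\<exists>r. strict_mono r \<and> sigma_Cauchy Y (u \<circ> r))) \<longrightarrow>
        x extreme_point_of (cball 0 1) \<longrightarrow>
        strongly_extreme_point x {u. N u \<le> 1} \<longrightarrow>
        strongly_extreme_point x (cball 0 1))"
proof -
  have x: "norm x = 1" using assms(2) by simp
  show ?thesis
    using point_of_continuity_transfer[OF assms(1) x]
      strongly_extreme_point_transfer[OF assms(1) x] by blast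
qed

end
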